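(* Let $V(x_1,\dots,x_m)$ be a homogeneous polynomial of degree $d$ with real coefficients. Then the following conditions are equivalent: (i) $\mathbb{R}_{\geq 0}\langle x^{k}\mid x\in A_{1}(V)\rangle=A_{k}(V)$ for every $k=1,\dots,d$; (ii) the homogeneous form $Q_{\alpha}:A_1(V)\to\mathbb{R}$, $Q_\alpha(x)=\alpha x^kV$, is admissible for every $k=1,\dots,d$ and every $\alpha\in A_{d-k}(V)$, $\alpha\ne 0$; (iii) for every homogeneous differential operator $D\in DOp_{\mathbb{R}}(\mathbb{R}^m)$ of degree $\deg D=k$, $k=0,\dots,d-1$, if the polynomial $DV$ is non-zero, then $DV$ takes values of opposite signs.
   Context: $DOp_{\mathbb{R}}(\mathbb{R}^m)=\mathbb{R}[\partial_1,\dots,\partial_m]$ is the algebra of differential operators in $m$ variables with constant real coefficients, graded by order. For a homogeneous polynomial $V\in\mathbb{R}[x_1,\dots,x_m]$ of degree $d$, $\mathrm{Ann}\,V=\{D\in DOp_{\mathbb{R}}(\mathbb{R}^m): DV=0\}$ and $A(V)=DOp_{\mathbb{R}}(\mathbb{R}^m)/\mathrm{Ann}\,V=\bigoplus_{i=0}^dA_i(V)$ with the induced grading. For $\alpha\in A_{d-k}(V)$ and $x\in A_1(V)$, $Q_\alpha(x)=\alpha x^kV\in\mathbb{R}$ is the result of applying the operator $\alpha x^k$ of order $d$ to $V$. $\mathbb{R}_{\ge0}\langle X\rangle$ is the convex cone of finite non-negative combinations of elements of $X$. A form is admissible if it is not semidefinite, i.e. takes both strictly positive and strictly negative values. *)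

theory Defs
  imports
    "HOL-Library.Poly_Mapping"
    "HOL-Algebra.Algebraic_Closure_Type"
    "HOL-Algebra.QuotRing"
    "HOL-Algebra.Module"
    "HOL-Analysis.Finite_Cartesian_Product"
begin

unbundle no fps_syntax

text \<open>
  The finite type \<open>'m\<close> indexes the \<open>m\<close> variables. An element of \<open>'m mpolynomial\<close> is a finitely
  supported family of real coefficients indexed by exponent vectors; the product of
  \<open>Poly_Mapping\<close> is the convolution. Constant-coefficient differential operators are
  polynomials in the \<open>\<partial>\<^sub>i\<close>, hence carry the same type.
\<close>

type_synonym 'm mpolynomial = "('m \<Rightarrow>\<^sub>0 nat) \<Rightarrow>\<^sub>0 real"
type_synonym 'm dop = "'m mpolynomial"

definition homogeneous :: "nat \<Rightarrow> 'm::finite mpolynomial \<Rightarrow> bool" where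
  "homogeneous n P \<longleftrightarrow> (\<forall>a\<in>Poly_Mapping.keys P. (\<Sum>i\<in>UNIV. Poly_Mapping.lookup a i) = n)"

definition mpoly_eval :: "'m::finite mpolynomial \<Rightarrow> real ^ 'm \<Rightarrow> real" where
  "mpoly_eval P x = (\<Sum>a\<in>Poly_Mapping.keys P. Poly_Mapping.lookup P a * (\<Prod>i\<in>UNIV. (x $ i) ^ Poly_Mapping.lookup a i))"

text \<open>For \<open>Poly_Mapping.lookup a i = 0\<close> the truncated exponent vector comes with the coefficient \<open>0\<close>.\<close>

definition partial :: "'m \<Rightarrow> 'm mpolynomial \<Rightarrow> 'm mpolynomial" where
  "partial i P =
     (\<Sum>a\<in>Poly_Mapping.keys P. Poly_Mapping.single (a - Poly_Mapping.single i 1)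
                     (real (Poly_Mapping.lookup a i) * Poly_Mapping.lookup P a))"

text \<open>
  The iterated partial derivative \<open>\<Prod>\<^sub>i \<partial>\<^sub>i\<^bsup>a i\<^esup> P\<close>. The order in which the fold takes the
  indices is irrelevant because partial derivatives commute (\<open>partials_commute\<close> below).
\<close>

definition partials :: "('m::finite \<Rightarrow>\<^sub>0 nat) \<Rightarrow> 'm mpolynomial \<Rightarrow> 'm mpolynomial" where
  "partials a P = Finite_Set.fold (\<lambda>i. partial i ^^ Poly_Mapping.lookup a i) P UNIV"

definition const :: "real \<Rightarrow> 'm mpolynomial" where
  "const c = Poly_Mapping.single 0 c"

definition dop_apply :: "'m::finite dop \<Rightarrow> 'm mpolynomial \<Rightarrow> 'm mpolynomial" where
  "dop_apply D P = (\<Sum>a\<in>Poly_Mapping.keys D. const (Poly_Mapping.lookup D a) * partials a P)"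

definition DOp :: "'m::finite dop ring" where
  "DOp = ring_of_type_algebra"

definition Ann :: "'m::finite mpolynomial \<Rightarrow> 'm dop set" where
  "Ann V = {D. dop_apply D V = 0}"

definition AV :: "'m::finite mpolynomial \<Rightarrow> 'm dop set ring" where
  "AV V = DOp Quot Ann V"

definition AV_part :: "'m::finite mpolynomial \<Rightarrow> nat \<Rightarrow> 'm dop set set" where
  "AV_part V k = {Ann V +>\<^bsub>DOp\<^esub> D | D. homogeneous k D}"

text \<open>The real scalar multiplication of the algebra \<open>A(V)\<close>.\<close>

definition AV_scale :: "'m::finite mpolynomial \<Rightarrow> real \<Rightarrow> 'm dop set \<Rightarrow> 'm dop set" where
  "AV_scale V c \<xi> = (Ann V +>\<^bsub>DOp\<^esub> const c) \<otimes>\<^bsub>AV V\<^esub> \<xi>"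

definition AV_cone :: "'m::finite mpolynomial \<Rightarrow> 'm dop set set \<Rightarrow> 'm dop set set" where
  "AV_cone V S =
     {(\<Oplus>\<^bsub>AV V\<^esub>\<xi>\<in>Y. AV_scale V (c \<xi>) \<xi>) | Y c. finite Y \<and> Y \<subseteq> S \<and> (\<forall>\<xi>\<in>Y. 0 \<le> c \<xi>)}"

text \<open>
  All representatives \<open>D\<close> of a class \<open>\<xi>\<close> in \<open>A(V)\<close> give the same polynomial \<open>D V\<close>
  (\<open>AV_apply_rcos\<close> below).
\<close>

definition AV_apply :: "'m::finite dop set \<Rightarrow> 'm mpolynomial \<Rightarrow> 'm mpolynomial" where
  "AV_apply \<xi> V = the_elem ((\<lambda>D. dop_apply D V) ` \<xi>)"

text \<open>
  For \<open>V\<close> homogeneous of degree \<open>d\<close>, \<open>\<alpha>\<close> in degree \<open>d - k\<close> and \<open>x\<close> in degree \<open>1\<close> the polynomial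
  \<open>\<alpha> x\<^sup>k V\<close> is constant (\<open>Q_form_const\<close> below), and \<open>Q_form\<close> reads off its value.
\<close>

definition Q_form :: "'m::finite mpolynomial \<Rightarrow> nat \<Rightarrow> 'm dop set \<Rightarrow> 'm dop set \<Rightarrow> real" where
  "Q_form V k \<alpha> x = Poly_Mapping.lookup (AV_apply (\<alpha> \<otimes>\<^bsub>AV V\<^esub> x [^]\<^bsub>AV V\<^esub> k) V) 0"

definition admissible_on :: "'a set \<Rightarrow> ('a \<Rightarrow> real) \<Rightarrow> bool" where
  "admissible_on S f \<longleftrightarrow> (\<exists>x\<in>S. 0 < f x) \<and> (\<exists>y\<in>S. f y < 0)"

lemma lookup_partial:
  "Poly_Mapping.lookup (partial i P) b =
     (real (Poly_Mapping.lookup b i) + 1) * Poly_Mapping.lookup P (b + Poly_Mapping.single i 1)"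
proof -
  let ?s = "Poly_Mapping.single i (1::nat)"
  have key: "real (Poly_Mapping.lookup a i) * Poly_Mapping.lookup P a = 0"
    if "a - ?s = b" "a \<noteq> b + ?s" for a
  proof -
    have "Poly_Mapping.lookup a i = 0"
    proof (rule ccontr)
      assume "Poly_Mapping.lookup a i \<noteq> 0"
      then have "a = (a - ?s) + ?s"
        by (intro poly_mapping_eqI) (auto simp: lookup_add lookup_minus lookup_single when_def)
      with that show False by simp
    qed
    then show ?thesis by simp
  qed
  have "Poly_Mapping.lookup (partial i P) b =
      (\<Sum>a\<in>Poly_Mapping.keys P.
         if a - ?s = b then real (Poly_Mapping.lookup a i) * Poly_Mapping.lookup P a else 0)"
    by (simp add: partial_def lookup_sum lookup_single when_def)
  also have "\<dots> = (\<Sum>a\<in>Poly_Mapping.keys P.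
         if a = b + ?s then (real (Poly_Mapping.lookup b i) + 1) * Poly_Mapping.lookup P (b + ?s) else 0)"
    by (intro sum.cong refl) (use key in \<open>auto simp: lookup_add lookup_single\<close>)
  also have "\<dots> = (real (Poly_Mapping.lookup b i) + 1) * Poly_Mapping.lookup P (b + ?s)"
    by (auto simp: in_keys_iff)
  finally show ?thesis .
qed

lemma partials_commute:
  "comp_fun_commute (\<lambda>i. partial i ^^ Poly_Mapping.lookup a i)"
proof -
  have swap: "partial i (partial j P) = partial j (partial i P)" for i j :: 'a and P
    by (intro poly_mapping_eqI)
      (auto simp: lookup_partial lookup_add lookup_single when_def ac_simps)
  have swap1: "(partial i ^^ m) (partial j P) = partial j ((partial i ^^ m) P)"
    for i j :: 'a and P m
    by (induction m) (auto simp: swap)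
  have "(partial i ^^ m) ((partial j ^^ n) P) = (partial j ^^ n) ((partial i ^^ m) P)"
    for i j :: 'a and P m n
    by (induction n) (auto simp: swap1)
  then show ?thesis
    by unfold_locales (auto simp: fun_eq_iff)
qed

lemma lookup_partials:
  "Poly_Mapping.lookup (partials a P) b =
     (\<Prod>i\<in>UNIV. fact (Poly_Mapping.lookup b i + Poly_Mapping.lookup a i)
                  / fact (Poly_Mapping.lookup b i)) * Poly_Mapping.lookup P (b + a)"
proof -
  interpret comp_fun_commute "\<lambda>i. partial i ^^ Poly_Mapping.lookup a i"
    by (rule partials_commute)
  have pow: "Poly_Mapping.lookup ((partial i ^^ n) Q) b =
      fact (Poly_Mapping.lookup b i + n) / fact (Poly_Mapping.lookup b i)
        * Poly_Mapping.lookup Q (b + Poly_Mapping.single i n)" for i n b and Q :: "'a mpolynomial"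
  proof (induction n arbitrary: b)
    case (Suc n)
    have "b + Poly_Mapping.single i 1 + Poly_Mapping.single i n = b + Poly_Mapping.single i (Suc n)"
      by (simp add: add.assoc flip: single_add)
    moreover have "(real k + 1) * (fact (Suc k + n) / fact (Suc k) * z) = fact (k + Suc n) / fact k * z"
      for k z
      by (simp add: divide_simps)
    ultimately show ?case
      by (simp only: lookup_partial Suc lookup_add lookup_single_eq funpow.simps o_apply
          flip: Suc_eq_plus1)
  qed auto
  have "Poly_Mapping.lookup (Finite_Set.fold (\<lambda>i. partial i ^^ Poly_Mapping.lookup a i) P A) b =
     (\<Prod>i\<in>A. fact (Poly_Mapping.lookup b i + Poly_Mapping.lookup a i)
                  / fact (Poly_Mapping.lookup b i)) *
       Poly_Mapping.lookup P (b + (\<Sum>i\<in>A. Poly_Mapping.single i (Poly_Mapping.lookup a i)))"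
    if "finite A" for A b
    using that
  proof (induction A arbitrary: b rule: finite_induct)
    case (insert j A)
    then have "j \<noteq> i" if "i \<in> A" for i using that by auto
    with insert show ?case
      by (simp add: pow lookup_add lookup_single add.assoc cong: prod.cong)
  qed auto
  moreover have "(\<Sum>i\<in>UNIV. Poly_Mapping.single i (Poly_Mapping.lookup a i)) = a"
    by (intro poly_mapping_eqI) (simp add: lookup_sum lookup_single when_def)
  ultimately show ?thesis
    by (simp add: partials_def)
qed

lemma dop_apply_alt:
  assumes "finite A" "Poly_Mapping.keys D \<subseteq> A"
  shows "dop_apply D P = (\<Sum>a\<in>A. const (Poly_Mapping.lookup D a) * partials a P)"
  unfolding dop_apply_def
  by (rule sum.mono_neutral_left) (use assms in \<open>auto simp: in_keys_iff const_def\<close>)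

lemma dop_apply_add: "dop_apply (D + E) P = dop_apply D P + dop_apply E P"
proof -
  let ?A = "Poly_Mapping.keys D \<union> Poly_Mapping.keys E"
  have "Poly_Mapping.keys (D + E) \<subseteq> ?A" by (rule Poly_Mapping.keys_add)
  then show ?thesis
    by (simp add: dop_apply_alt[of ?A] lookup_add const_def single_add distrib_right sum.distrib)
qed

lemma dop_apply_minus: "dop_apply (- D) P = - dop_apply D P"
  by (simp add: dop_apply_def const_def single_uminus sum_negf)

lemma dop_apply_zero [simp]: "dop_apply 0 P = 0"
  by (simp add: dop_apply_def)

lemma dop_apply_sum: "dop_apply (sum f A) P = (\<Sum>x\<in>A. dop_apply (f x) P)"
  by (induction A rule: infinite_finite_induct) (auto simp: dop_apply_add)

lemma lookup_const_mult: "Poly_Mapping.lookup (const c * P) b = c * Poly_Mapping.lookup P b"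
proof -
  have "const c * P = Poly_Mapping.map ((*) c) P"
    by (simp add: const_def mult_map_scale_conv_mult)
  then show ?thesis
    by (simp add: Poly_Mapping.map.rep_eq when_def)
qed

lemma lookup_dop_apply:
  "Poly_Mapping.lookup (dop_apply D P) b =
     (\<Sum>a\<in>Poly_Mapping.keys D. Poly_Mapping.lookup D a * Poly_Mapping.lookup (partials a P) b)"
  by (simp add: dop_apply_def lookup_sum lookup_const_mult)

lemma dop_apply_right_add: "dop_apply D (P + Q) = dop_apply D P + dop_apply D Q"
  by (intro poly_mapping_eqI)
    (simp add: lookup_dop_apply lookup_add lookup_partials distrib_left sum.distrib)

lemma dop_apply_right_sum: "dop_apply D (sum f A) = (\<Sum>x\<in>A. dop_apply D (f x))"
proof -
  have "dop_apply D 0 = 0"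
    by (intro poly_mapping_eqI) (simp add: lookup_dop_apply lookup_partials)
  then show ?thesis
    by (induction A rule: infinite_finite_induct) (auto simp: dop_apply_right_add)
qed

lemma dop_apply_single: "dop_apply (Poly_Mapping.single a c) P = const c * partials a P"
  by (simp add: dop_apply_def const_def)

lemma dop_apply_single_mult:
  "dop_apply (Poly_Mapping.single a c * Poly_Mapping.single b e) P =
     dop_apply (Poly_Mapping.single a c) (dop_apply (Poly_Mapping.single b e) P)"
  unfolding mult_single dop_apply_single
proof (intro poly_mapping_eqI)
  fix q
  have "(\<Prod>i\<in>UNIV. fact (Poly_Mapping.lookup q i + Poly_Mapping.lookup (a + b) i)
                  / fact (Poly_Mapping.lookup q i) :: real) =
    (\<Prod>i\<in>UNIV. fact (Poly_Mapping.lookup q i + Poly_Mapping.lookup a i)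
                  / fact (Poly_Mapping.lookup q i)) *
    (\<Prod>i\<in>UNIV. fact (Poly_Mapping.lookup (q + a) i + Poly_Mapping.lookup b i)
                  / fact (Poly_Mapping.lookup (q + a) i))"
    unfolding prod.distrib[symmetric] by (intro prod.cong) (auto simp: lookup_add add.assoc)
  then show "Poly_Mapping.lookup (const (c * e) * partials (a + b) P) q =
      Poly_Mapping.lookup (const c * partials a (const e * partials b P)) q"
    by (simp add: lookup_const_mult lookup_partials add.assoc)
qed

text \<open>The product of \<open>DOp\<close> is the composition of operators.\<close>

lemma dop_apply_mult: "dop_apply (D * E) P = dop_apply D (dop_apply E P)"
proof -
  have dec: "D = (\<Sum>a\<in>Poly_Mapping.keys D. Poly_Mapping.single a (Poly_Mapping.lookup D a))"
    for D :: "'a dop"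
    by (intro poly_mapping_eqI)
      (auto simp: lookup_sum lookup_single when_def in_keys_iff)
  show ?thesis
    apply (subst (1 2) dec[of D], subst (1 2) dec[of E])
    apply (simp add: sum_product dop_apply_sum dop_apply_right_sum dop_apply_single_mult)
    by (rule sum.swap)
qed


lemma mpoly_eval_alt:
  assumes "finite A" "Poly_Mapping.keys P \<subseteq> A"
  shows "mpoly_eval P x =
    (\<Sum>a\<in>A. Poly_Mapping.lookup P a * (\<Prod>i\<in>UNIV. (x $ i) ^ Poly_Mapping.lookup a i))"
  unfolding mpoly_eval_def
  by (rule sum.mono_neutral_left) (use assms in \<open>auto simp: in_keys_iff\<close>)

lemma mpoly_eval_add: "mpoly_eval (P + Q) x = mpoly_eval P x + mpoly_eval Q x"
proof -
  let ?A = "Poly_Mapping.keys P \<union> Poly_Mapping.keys Q"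
  have "Poly_Mapping.keys (P + Q) \<subseteq> ?A" by (rule Poly_Mapping.keys_add)
  then show ?thesis
    by (simp add: mpoly_eval_alt[of ?A] lookup_add distrib_right sum.distrib)
qed

lemma mpoly_eval_sum: "mpoly_eval (sum f A) x = (\<Sum>y\<in>A. mpoly_eval (f y) x)"
  by (induction A rule: infinite_finite_induct) (auto simp: mpoly_eval_add, simp_all add: mpoly_eval_def)

lemma mpoly_eval_single:
  "mpoly_eval (Poly_Mapping.single a c) x = c * (\<Prod>i\<in>UNIV. (x $ i) ^ Poly_Mapping.lookup a i)"
  by (simp add: mpoly_eval_def)

lemma mpoly_eval_partial:
  "((\<lambda>t. mpoly_eval P (\<chi> j. if j = i then t else x $ j)) has_real_derivative
      mpoly_eval (partial i P) x) (at (x $ i))"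
proof -
  let ?rest = "\<lambda>a. \<Prod>j\<in>UNIV - {i}. (x $ j) ^ Poly_Mapping.lookup a j"
  have split: "(\<Prod>j\<in>UNIV. f j) = f i * (\<Prod>j\<in>UNIV - {i}. f j)" for f :: "'a \<Rightarrow> real"
    by (simp add: prod.remove)
  have lhs: "mpoly_eval P (\<chi> j. if j = i then t else x $ j) =
    (\<Sum>a\<in>Poly_Mapping.keys P. Poly_Mapping.lookup P a * (t ^ Poly_Mapping.lookup a i * ?rest a))" for t
    unfolding mpoly_eval_def split by (simp cong: prod.cong_simp)
  have rhs: "mpoly_eval (partial i P) x =
    (\<Sum>a\<in>Poly_Mapping.keys P. Poly_Mapping.lookup P a *
      (real (Poly_Mapping.lookup a i) * (x $ i) ^ (Poly_Mapping.lookup a i - 1) * ?rest a))"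
    unfolding partial_def mpoly_eval_sum mpoly_eval_single split
    by (intro sum.cong refl) (simp add: lookup_minus lookup_single when_def mult_ac cong: prod.cong_simp)
  show ?thesis
    unfolding lhs rhs
    by (rule derivative_eq_intros refl | simp add: mult_ac)+
qed

lemma cring_DOp: "cring DOp"
  unfolding DOp_def by (rule cring_from_type_algebra)

lemma DOp_simps [simp]:
  "carrier DOp = UNIV" "D \<otimes>\<^bsub>DOp\<^esub> E = D * E" "D \<oplus>\<^bsub>DOp\<^esub> E = D + E"
  "\<one>\<^bsub>DOp\<^esub> = 1" "\<zero>\<^bsub>DOp\<^esub> = 0"
  by (simp_all add: DOp_def ring_of_type_algebra_def)

lemma ideal_Ann: "ideal (Ann V) DOp"
proof -
  interpret cring DOp by (rule cring_DOp)
  have minus: "\<ominus>\<^bsub>DOp\<^esub> D = - D" for D :: "'a dop"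
    by (rule minus_equality) auto
  have zero: "dop_apply D 0 = 0" for D :: "'a dop"
    using dop_apply_right_sum[of D "\<lambda>_. 0" "{}"] by simp
  show ?thesis
  proof (rule idealI[OF ring_axioms])
    show "subgroup (Ann V) (add_monoid DOp)"
    proof (rule group.subgroupI[OF a_group], goal_cases)
      case (3 D)
      then show ?case unfolding a_inv_def[symmetric] minus by (simp add: Ann_def dop_apply_minus)
    qed (auto simp: Ann_def dop_apply_add intro: exI[of _ 0])
    fix D E :: "'a dop"
    assume D: "D \<in> Ann V"
    then show "E \<otimes>\<^bsub>DOp\<^esub> D \<in> Ann V" by (simp add: Ann_def dop_apply_mult zero)
    with D show "D \<otimes>\<^bsub>DOp\<^esub> E \<in> Ann V" by (simp add: Ann_def mult.commute[of D])
  qed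
qed

lemma AV_apply_rcos: "AV_apply (Ann V +>\<^bsub>DOp\<^esub> D) V = dop_apply D V"
proof -
  have "(\<lambda>E. dop_apply E V) ` (Ann V +>\<^bsub>DOp\<^esub> D) = {dop_apply D V}"
    by (auto simp: a_r_coset_def' Ann_def dop_apply_add image_iff intro: exI[of _ D] exI[of _ 0])
  then show ?thesis by (simp add: AV_apply_def)
qed

lemma homogeneous_mult:
  assumes "homogeneous m P" "homogeneous n Q"
  shows "homogeneous (m + n) (P * Q)"
  using assms unfolding homogeneous_def
  by (auto dest!: subsetD[OF keys_mult] simp: lookup_add sum.distrib)

lemma homogeneous_power: "homogeneous m P \<Longrightarrow> homogeneous (k * m) (P ^ k)"
  by (induction k) (auto simp: homogeneous_mult, simp add: homogeneous_def)

lemma dop_apply_const: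
  assumes "homogeneous d V" "homogeneous d D"
  shows "dop_apply D V = const (Poly_Mapping.lookup (dop_apply D V) 0)"
proof (rule poly_mapping_eqI)
  fix b
  have "Poly_Mapping.lookup (dop_apply D V) b = 0" if "b \<noteq> 0"
  proof -
    from that obtain i where "Poly_Mapping.lookup b i \<noteq> 0"
      by (metis poly_mapping_eqI lookup_zero)
    then have "(\<Sum>i\<in>UNIV. Poly_Mapping.lookup b i) > 0"
      by (metis UNIV_I finite gr0I sum_eq_0_iff)
    have "Poly_Mapping.lookup V (b + a) = 0" if "a \<in> Poly_Mapping.keys D" for a
    proof (rule ccontr)
      assume "Poly_Mapping.lookup V (b + a) \<noteq> 0"
      then have "b + a \<in> Poly_Mapping.keys V" by (simp add: in_keys_iff)
      with assms(1) have "(\<Sum>i\<in>UNIV. Poly_Mapping.lookup (b + a) i) = d"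
        by (simp add: homogeneous_def)
      moreover have "(\<Sum>i\<in>UNIV. Poly_Mapping.lookup a i) = d"
        using that assms(2) by (simp add: homogeneous_def)
      ultimately show False
        using \<open>(\<Sum>i\<in>UNIV. Poly_Mapping.lookup b i) > 0\<close> by (simp add: lookup_add sum.distrib)
    qed
    then show ?thesis
      by (simp add: lookup_dop_apply lookup_partials)
  qed
  then show "Poly_Mapping.lookup (dop_apply D V) b =
      Poly_Mapping.lookup (const (Poly_Mapping.lookup (dop_apply D V) 0)) b"
    by (auto simp: const_def lookup_single when_def)
qed

lemma Q_form_const:
  assumes "homogeneous d V" "k \<le> d" "\<alpha> \<in> AV_part V (d - k)" "x \<in> AV_part V 1"
  shows "AV_apply (\<alpha> \<otimes>\<^bsub>AV V\<^esub> x [^]\<^bsub>AV V\<^esub> k) V = const (Q_form V k \<alpha> x)"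
proof -
  interpret ideal "Ann V" DOp by (rule ideal_Ann)
  obtain D E where DE: "\<alpha> = Ann V +>\<^bsub>DOp\<^esub> D" "homogeneous (d - k) D"
      "x = Ann V +>\<^bsub>DOp\<^esub> E" "homogeneous 1 E"
    using assms unfolding AV_part_def by auto
  have mult: "(Ann V +>\<^bsub>DOp\<^esub> F) \<otimes>\<^bsub>AV V\<^esub> (Ann V +>\<^bsub>DOp\<^esub> G) = Ann V +>\<^bsub>DOp\<^esub> (F * G)" for F G
    using rcoset_mult_add[of F G] by (simp add: AV_def FactRing_def)
  have "x [^]\<^bsub>AV V\<^esub> n = Ann V +>\<^bsub>DOp\<^esub> E ^ n" for n :: nat
    by (induction n) (simp_all add: DE mult nat_pow_def mult.commute, simp add: AV_def FactRing_def)
  then have *: "\<alpha> \<otimes>\<^bsub>AV V\<^esub> x [^]\<^bsub>AV V\<^esub> k = Ann V +>\<^bsub>DOp\<^esub> (D * E ^ k)"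
    by (simp add: DE mult)
  have "homogeneous d (D * E ^ k)"
    using homogeneous_mult[OF DE(2) homogeneous_power[OF DE(4), of k]] assms(2) by simp
  then show ?thesis
    using dop_apply_const[OF assms(1)] by (simp add: Q_form_def * AV_apply_rcos)
qed

end

theory Submission
  imports Defs
begin

text \<open>
  If \<open>P\<close> is homogeneous of degree \<open>k\<close> and \<open>x = \<Sum>\<^sub>i a\<^sub>i \<partial>\<^sub>i\<close>, then \<open>x\<^sup>k P = k! P(a)\<close>. Applied to
  \<open>P = D V\<close> this identifies the form \<open>Q\<^sub>\<alpha>\<close> with \<open>D V\<close> up to a positive factor, so (ii) and (iii)
  agree. For (i) and (ii), every linear functional on \<open>A\<^sub>k(V)\<close> is given by some
  \<open>\<alpha> \<in> A\<^bsub>d-k\<^esub>(V)\<close>, and a convex cone in a finite-dimensional space is the whole space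
  iff no nonzero functional is non-negative on it.
\<close>

section \<open>Cones on which every nonzero functional changes sign\<close>

text \<open>
  Coordinates are eliminated one at a time: a functional that is non-negative on the slice of the
  cone where the coordinate \<open>j\<close> vanishes extends, by a suitable coefficient \<open>t\<close> at \<open>j\<close>, to
  one that is non-negative on the whole cone.
\<close>

lemma convex_cone_fills_space:
  fixes C W :: "('a \<Rightarrow> real) set"
  assumes "finite I"
    and "C \<subseteq> W" "(\<lambda>_. 0) \<in> C"
    and "\<And>c c' s t. c \<in> C \<Longrightarrow> c' \<in> C \<Longrightarrow> 0 \<le> s \<Longrightarrow> 0 \<le> t \<Longrightarrow> (\<lambda>i. s * c i + t * c' i) \<in> C"
    and "\<And>w w' s t. w \<in> W \<Longrightarrow> w' \<in> W \<Longrightarrow> (\<lambda>i. s * w i + t * w' i) \<in> W"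
    and "\<And>f w. w \<in> W \<Longrightarrow> (\<Sum>i\<in>I. f i * w i) \<noteq> 0 \<Longrightarrow> \<exists>c\<in>C. (\<Sum>i\<in>I. f i * c i) < 0"
    and "w \<in> W"
  shows "\<exists>c\<in>C. \<forall>i\<in>I. c i = w i"
  using assms
proof (induction I arbitrary: C W w rule: finite_induct)
  case empty
  then show ?case by auto
next
  case (insert j J C W w)
  note C = insert.prems(3) and W = insert.prems(4) and sep = insert.prems(5)
  have upd: "(\<Sum>i\<in>insert j J. (f(j := t)) i * c i) = t * c j + (\<Sum>i\<in>J. f i * c i)" for f t c
  proof -
    have "(\<Sum>i\<in>J. (f(j := t)) i * c i) = (\<Sum>i\<in>J. f i * c i)"
      using insert.hyps by (intro sum.cong) auto
    then show ?thesis using insert.hyps by simp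
  qed
  show ?case
  proof (cases "\<forall>w\<in>W. w j = 0")
    \<comment> \<open>Nothing in \<open>W\<close> sees the coordinate \<open>j\<close>, so the
      separation hypothesis passes to \<open>J\<close> by giving \<open>j\<close> the coefficient
      0.\<close>
    case True
    have "\<exists>c\<in>C. \<forall>i\<in>J. c i = w i"
    proof (rule insert.IH[OF insert.prems(1,2) C W _ insert.prems(6)])
      fix f v
      assume "v \<in> W" "(\<Sum>i\<in>J. f i * v i) \<noteq> 0"
      then show "\<exists>c\<in>C. (\<Sum>i\<in>J. f i * c i) < 0"
        using sep[of v "f(j := 0)"] unfolding upd by simp
    qed auto
    then obtain c where c: "c \<in> C" "\<forall>i\<in>J. c i = w i" by blast
    moreover from c(1) insert.prems(1,6) have "c j = 0" "w j = 0"
      using True by blast+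
    ultimately show ?thesis by auto
  next
    case False
    then obtain v where v: "v \<in> W" "v j \<noteq> 0" by blast
    \<comment> \<open>The coordinate functional at \<open>j\<close> and its negative do not vanish
      on \<open>W\<close>, so \<open>C\<close> has elements on both sides of the hyperplane where
      \<open>j\<close> vanishes.\<close>
    obtain n where n: "n \<in> C" "n j < 0"
      using sep[of v "(\<lambda>_. 0)(j := 1)"] v unfolding upd by auto
    obtain p where p: "p \<in> C" "p j > 0"
      using sep[of v "(\<lambda>_. 0)(j := - 1)"] v unfolding upd by auto
    define C0 where "C0 = {c \<in> C. c j = 0}"
    define W0 where "W0 = {c \<in> W. c j = 0}"
    have fill: "\<exists>c\<in>C0. \<forall>i\<in>J. c i = y i" if "y \<in> W0" for y
    proof (rule insert.IH[OF _ _ _ _ _ that])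
      show "C0 \<subseteq> W0" "(\<lambda>_. 0) \<in> C0"
        using insert.prems(1,2) by (auto simp: C0_def W0_def)
      show "(\<lambda>i. s * c i + t * c' i) \<in> C0"
        if "c \<in> C0" "c' \<in> C0" "0 \<le> s" "0 \<le> t" for c c' s t
        using that C by (auto simp: C0_def)
      show "(\<lambda>i. s * c i + t * c' i) \<in> W0" if "c \<in> W0" "c' \<in> W0" for c c' s t
        using that W by (auto simp: W0_def)
      fix f u
      assume u: "u \<in> W0" "(\<Sum>i\<in>J. f i * u i) \<noteq> 0"
      let ?f = "\<lambda>c. \<Sum>i\<in>J. f i * c i"
      show "\<exists>c\<in>C0. ?f c < 0"
      proof (rule ccontr)
        assume "\<not> ?thesis"
        then have nonneg: "0 \<le> ?f c" if "c \<in> C0" for c using that by force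
        \<comment> \<open>An element \<open>c\<close> with \<open>0 < c j\<close> forces
          \<open>t\<close> to be at least \<open>- ?f c / c j\<close>, and one with
          \<open>c j < 0\<close> bounds \<open>t\<close> from above by \<open>?f c / - c j\<close>.
          By \<open>cross\<close> no lower bound exceeds an upper one, so \<open>t = Sup A\<close>
          meets all of them.\<close>
        define A where "A = (\<lambda>c. - ?f c / c j) ` {c \<in> C. 0 < c j}"
        have cross: "- ?f c / c j \<le> ?f c' / - c' j"
          if "c \<in> C" "0 < c j" "c' \<in> C" "c' j < 0" for c c'
        proof -
          \<comment> \<open>These non-negative weights cancel the coordinate \<open>j\<close>, which
            brings the combination into the slice.\<close>
          have "(\<lambda>i. - c' j * c i + c j * c' i) \<in> C0"
            using C[OF that(1,3), of "- c' j" "c j"] that by (simp add: C0_def)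
          from nonneg[OF this] have "0 \<le> - c' j * ?f c + c j * ?f c'"
            by (simp add: sum_distrib_left sum.distrib sum_negf sum_subtractf algebra_simps)
          then show ?thesis using that by (simp add: field_simps)
        qed
        have A: "A \<noteq> {}" "bdd_above A"
        proof -
          show "A \<noteq> {}" using p by (auto simp: A_def)
          show "bdd_above A"
            by (rule bdd_aboveI[of _ "?f n / - n j"]) (use cross[OF _ _ n] in \<open>auto simp: A_def\<close>)
        qed
        have "0 \<le> Sup A * c j + ?f c" if c: "c \<in> C" for c
        proof (cases "c j" "0 :: real" rule: linorder_cases)
          case less
          then have "Sup A \<le> ?f c / - c j"
            using A(1) cross[OF _ _ c] by (intro cSup_least) (auto simp: A_def)
          with less show ?thesis by (simp add: field_simps)
        next
          case equal
          with c nonneg show ?thesis by (simp add: C0_def)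
        next
          case greater
          then have "- ?f c / c j \<le> Sup A"
            using A(2) c by (intro cSup_upper) (auto simp: A_def)
          with greater show ?thesis by (simp add: field_simps)
        qed
        then have "\<not> (\<exists>c\<in>C. (\<Sum>i\<in>insert j J. (f(j := Sup A)) i * c i) < 0)"
          unfolding upd by (simp add: not_less)
        \<comment> \<open>Since \<open>u j = 0\<close>, the extended functional agrees with
          \<open>f\<close> on \<open>u\<close> whatever the value at \<open>j\<close>, so it is
          still nonzero on \<open>W\<close> and \<open>sep\<close> applies to it.\<close>
        moreover have "(\<Sum>i\<in>insert j J. (f(j := Sup A)) i * u i) \<noteq> 0"
          unfolding upd using u by (simp add: W0_def)
        ultimately show False
          using sep[of u "f(j := Sup A)"] u(1) unfolding W0_def by blast
      qed
    qed
    \<comment> \<open>A multiple of \<open>p\<close> or \<open>n\<close> first matches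
      \<open>w\<close> at \<open>j\<close>. The remainder \<open>w - q\<close> lies in the slice
      \<open>W0\<close>, where \<open>fill\<close> supplies the other coordinates.\<close>
    obtain q where q: "q \<in> C" "q j = w j"
    proof (cases "0 \<le> w j")
      case True
      then show ?thesis
        using C[OF p(1) p(1), of "w j / p j" 0] p(2) by (intro that[of "\<lambda>i. w j / p j * p i + 0 * p i"]) auto
    next
      case False
      then show ?thesis
        using C[OF n(1) n(1), of "w j / n j" 0] n(2)
        by (intro that[of "\<lambda>i. w j / n j * n i + 0 * n i"]) (auto simp: divide_nonpos_neg)
    qed
    have "(\<lambda>i. 1 * w i + (- 1) * q i) \<in> W"
      using W[OF insert.prems(6), of q 1 "- 1"] q insert.prems(1) by auto
    then have "(\<lambda>i. 1 * w i + (- 1) * q i) \<in> W0"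
      using q by (simp add: W0_def)
    from fill[OF this] obtain r where r: "r \<in> C" "r j = 0" "\<forall>i\<in>J. r i = w i - q i"
      by (auto simp: C0_def)
    show ?thesis
      using C[OF q(1) r(1), of 1 1] q r
      by (intro bexI[of _ "\<lambda>i. 1 * q i + 1 * r i"]) auto
  qed
qed

section \<open>Homogeneous polynomials and operators\<close>

lemma homogeneous_0 [simp]: "homogeneous n 0"
  by (simp add: homogeneous_def)

lemma homogeneous_add: "homogeneous n P \<Longrightarrow> homogeneous n Q \<Longrightarrow> homogeneous n (P + Q)"
  unfolding homogeneous_def using Poly_Mapping.keys_add[of P Q] by blast

lemma homogeneous_sum: "(\<And>x. x \<in> A \<Longrightarrow> homogeneous n (f x)) \<Longrightarrow> homogeneous n (sum f A)"
  by (induction A rule: infinite_finite_induct) (auto intro: homogeneous_add)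

lemma homogeneous_single: "(\<Sum>i\<in>UNIV. Poly_Mapping.lookup a i) = n \<Longrightarrow> homogeneous n (Poly_Mapping.single a c)"
  by (simp add: homogeneous_def)

lemma homogeneous_const_mult: "homogeneous n P \<Longrightarrow> homogeneous n (const c * P)"
  unfolding homogeneous_def by (auto simp: in_keys_iff lookup_const_mult)

text \<open>Each entry is bounded by the total degree. This provides the finite coordinate set that
  \<open>convex_cone_fills_space\<close> requires.\<close>

lemma finite_exponents: "finite {b :: 'm::finite \<Rightarrow>\<^sub>0 nat. (\<Sum>i\<in>UNIV. Poly_Mapping.lookup b i) = n}"
  (is "finite ?B")
proof -
  have *: "Poly_Mapping.lookup b i \<le> (\<Sum>i\<in>UNIV. Poly_Mapping.lookup b i)" for b :: "'m \<Rightarrow>\<^sub>0 nat" and i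
    by (rule member_le_sum) auto
  have "Poly_Mapping.lookup ` ?B \<subseteq> {f. \<forall>i. (i \<in> UNIV \<longrightarrow> f i \<in> {..n}) \<and> (i \<notin> UNIV \<longrightarrow> f i = 0)}"
    using * by force
  moreover have "finite \<dots>"
    by (rule finite_set_of_finite_funs) simp_all
  ultimately have "finite (Poly_Mapping.lookup ` ?B)"
    by (rule finite_subset)
  moreover have "inj_on Poly_Mapping.lookup ?B"
    by (simp add: inj_on_def poly_mapping.lookup_inject)
  ultimately show ?thesis
    by (rule finite_imageD)
qed

text \<open>An exponent \<open>b\<close> of \<open>D V\<close> comes from an exponent
  \<open>b + a\<close> of \<open>V\<close> with \<open>a\<close> of degree \<open>k\<close>. For
  \<open>k > d\<close> there is no such \<open>b\<close>, so the truncated difference does no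
  harm.\<close>

lemma homogeneous_dop_apply:
  assumes "homogeneous d V" "homogeneous k D"
  shows "homogeneous (d - k) (dop_apply D V)"
  unfolding homogeneous_def
proof
  fix b
  assume "b \<in> Poly_Mapping.keys (dop_apply D V)"
  then have "(\<Sum>a\<in>Poly_Mapping.keys D. Poly_Mapping.lookup D a * Poly_Mapping.lookup (partials a V) b) \<noteq> 0"
    by (simp add: in_keys_iff lookup_dop_apply)
  then obtain a where a: "a \<in> Poly_Mapping.keys D" "Poly_Mapping.lookup (partials a V) b \<noteq> 0"
    by (metis (no_types, lifting) mult_zero_right sum.neutral)
  then have "b + a \<in> Poly_Mapping.keys V"
    by (auto simp: in_keys_iff lookup_partials)
  with assms a(1) have "(\<Sum>i\<in>UNIV. Poly_Mapping.lookup (b + a) i) = d"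
      "(\<Sum>i\<in>UNIV. Poly_Mapping.lookup a i) = k"
    unfolding homogeneous_def by blast+
  then show "(\<Sum>i\<in>UNIV. Poly_Mapping.lookup b i) = d - k"
    by (simp add: lookup_add sum.distrib)
qed

lemma partials_0 [simp]: "partials 0 P = P"
  by (intro poly_mapping_eqI) (simp add: lookup_partials)

lemma dop_apply_const_mult: "dop_apply (const c * D) P = const c * dop_apply D P"
  using dop_apply_single[of 0 c "dop_apply D P"] by (simp add: const_def dop_apply_mult)

text \<open>Monomial operators are dual to coefficients up to factorials, so every linear functional
  on the coefficients of a form comes from an operator.\<close>

lemma lookup_dop_apply_single_0:
  "Poly_Mapping.lookup (dop_apply (Poly_Mapping.single b c) P) 0 =
     c * (\<Prod>i\<in>UNIV. fact (Poly_Mapping.lookup b i)) * Poly_Mapping.lookup P b"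
  by (simp add: dop_apply_single lookup_const_mult lookup_partials)

section \<open>Linear operators and Euler's identity\<close>

text \<open>The derivative in direction \<open>a\<close>. Vectors thus parametrise the classes of
  degree 1, though distinct vectors may give the same class.\<close>

definition linear_dop :: "real ^ 'm \<Rightarrow> 'm::finite dop" where
  "linear_dop a = (\<Sum>i\<in>UNIV. Poly_Mapping.single (Poly_Mapping.single i 1) (a $ i))"

lemma homogeneous_linear_dop: "homogeneous 1 (linear_dop a)"
  unfolding linear_dop_def
  by (intro homogeneous_sum homogeneous_single) (simp add: lookup_single when_def)

lemma homogeneous_1_imp_linear_dop:
  assumes "homogeneous 1 L"
  shows "L = linear_dop (\<chi> i. Poly_Mapping.lookup L (Poly_Mapping.single i 1))"
proof (rule poly_mapping_eqI)
  fix b :: "'a \<Rightarrow>\<^sub>0 nat"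
  let ?s = "\<lambda>i. Poly_Mapping.single i (1::nat)"
  have *: "Poly_Mapping.lookup (linear_dop (\<chi> i. Poly_Mapping.lookup L (?s i))) b =
      (\<Sum>i\<in>UNIV. if ?s i = b then Poly_Mapping.lookup L b else 0)"
    by (auto simp: linear_dop_def lookup_sum lookup_single when_def simp del: One_nat_def intro!: sum.cong)
  have inj: "?s i = ?s j \<longleftrightarrow> i = j" for i j :: 'a
    by (metis lookup_single_eq lookup_single_not_eq zero_neq_one)
  show "Poly_Mapping.lookup L b =
      Poly_Mapping.lookup (linear_dop (\<chi> i. Poly_Mapping.lookup L (?s i))) b"
  proof (cases "b \<in> Poly_Mapping.keys L")
    case True
    with assms have "(\<Sum>i\<in>UNIV. Poly_Mapping.lookup b i) = 1"
      by (simp add: homogeneous_def)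
    then obtain i where i: "Poly_Mapping.lookup b i = 1" "\<forall>j. i \<noteq> j \<longrightarrow> Poly_Mapping.lookup b j = 0"
      using sum_eq_1_iff[of "UNIV :: 'a set" "Poly_Mapping.lookup b"] by auto
    then have "b = ?s i"
      by (intro poly_mapping_eqI) (auto simp: lookup_single when_def)
    then show ?thesis
      unfolding * by (simp add: inj del: One_nat_def)
  next
    case False
    then have "Poly_Mapping.lookup L b = 0" by (simp add: in_keys_iff)
    then show ?thesis
      unfolding * by (simp only: if_cancel sum.neutral_const)
  qed
qed

lemma homogeneous_1_iff: "homogeneous 1 L \<longleftrightarrow> (\<exists>a. L = linear_dop a)"
  using homogeneous_1_imp_linear_dop homogeneous_linear_dop by metis

lemma partials_single: "partials (Poly_Mapping.single i 1) P = partial i P"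
proof (rule poly_mapping_eqI)
  fix b
  have "fact (Poly_Mapping.lookup b j + Poly_Mapping.lookup (Poly_Mapping.single i 1) j)
          / fact (Poly_Mapping.lookup b j) =
      (if j = i then real (Poly_Mapping.lookup b i) + 1 else 1)" for j
    by (auto simp: lookup_single when_def)
  then show "Poly_Mapping.lookup (partials (Poly_Mapping.single i 1) P) b =
      Poly_Mapping.lookup (partial i P) b"
    by (simp add: lookup_partials lookup_partial)
qed

lemma mpoly_eval_const_mult: "mpoly_eval (const c * P) x = c * mpoly_eval P x"
proof -
  have "Poly_Mapping.keys (const c * P) \<subseteq> Poly_Mapping.keys P"
    by (auto simp: in_keys_iff lookup_const_mult)
  then show ?thesis
    by (simp add: mpoly_eval_alt[of "Poly_Mapping.keys P"] lookup_const_mult sum_distrib_left mult.assoc)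
qed

text \<open>The operator \<open>x $ i\<close> times \<open>partial i\<close>, evaluated at the same
  point \<open>x\<close>, multiplies each monomial by its exponent at \<open>i\<close>, and the
  exponents add up to \<open>n\<close>.\<close>

lemma euler_identity:
  assumes "homogeneous n P"
  shows "mpoly_eval (dop_apply (linear_dop x) P) x = real n * mpoly_eval P x"
proof -
  have shift: "x $ i * (real (Poly_Mapping.lookup a i) *
      (\<Prod>j\<in>UNIV. (x $ j) ^ Poly_Mapping.lookup (a - Poly_Mapping.single i 1) j)) =
      real (Poly_Mapping.lookup a i) * (\<Prod>j\<in>UNIV. (x $ j) ^ Poly_Mapping.lookup a j)" for i a
  proof (cases "Poly_Mapping.lookup a i = 0")
    case False
    have "(\<Prod>j\<in>UNIV. (x $ j) ^ Poly_Mapping.lookup a j) =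
      (\<Prod>j\<in>UNIV. (if j = i then x $ i else 1) * (x $ j) ^ Poly_Mapping.lookup (a - Poly_Mapping.single i 1) j)"
      using False
      by (intro prod.cong) (auto simp: lookup_minus lookup_single when_def simp flip: power_Suc)
    also have "\<dots> = x $ i * (\<Prod>j\<in>UNIV. (x $ j) ^ Poly_Mapping.lookup (a - Poly_Mapping.single i 1) j)"
      by (simp add: prod.distrib)
    finally show ?thesis by simp
  qed simp
  have "mpoly_eval (dop_apply (linear_dop x) P) x = (\<Sum>i\<in>UNIV. x $ i * mpoly_eval (partial i P) x)"
    by (simp add: linear_dop_def dop_apply_sum dop_apply_single mpoly_eval_sum mpoly_eval_const_mult
        partials_single flip: One_nat_def)
  also have "\<dots> = (\<Sum>i\<in>UNIV. \<Sum>a\<in>Poly_Mapping.keys P. Poly_Mapping.lookup P a *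
      (real (Poly_Mapping.lookup a i) * (\<Prod>j\<in>UNIV. (x $ j) ^ Poly_Mapping.lookup a j)))"
    unfolding partial_def mpoly_eval_sum mpoly_eval_single sum_distrib_left shift[symmetric]
    by (simp add: mult_ac)
  also have "\<dots> = (\<Sum>a\<in>Poly_Mapping.keys P. real (\<Sum>i\<in>UNIV. Poly_Mapping.lookup a i) *
      (Poly_Mapping.lookup P a * (\<Prod>j\<in>UNIV. (x $ j) ^ Poly_Mapping.lookup a j)))"
    by (subst sum.swap) (simp add: sum_distrib_left sum_distrib_right mult_ac)
  also have "\<dots> = real n * mpoly_eval P x"
    using assms by (simp add: homogeneous_def mpoly_eval_def sum_distrib_left)
  finally show ?thesis .
qed

text \<open>Each factor \<open>linear_dop x\<close> lowers the degree by one and, by Euler's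
  identity, multiplies the value at \<open>x\<close> by the current degree. These degrees collect to
  \<open>fact k\<close>.\<close>

lemma lookup_linear_dop_power:
  assumes "homogeneous k P"
  shows "Poly_Mapping.lookup (dop_apply (linear_dop x ^ k) P) 0 = fact k * mpoly_eval P x"
  using assms
proof (induction k arbitrary: P)
  case 0
  \<comment> \<open>A form of degree 0 is supported at the exponent 0, so its coefficient there is
    its value.\<close>
  have "a = 0" if "a \<in> Poly_Mapping.keys P" for a
    using 0 that by (intro poly_mapping_eqI) (auto simp: homogeneous_def)
  then have "Poly_Mapping.keys P \<subseteq> {0}" by blast
  moreover have "dop_apply 1 P = P"
    using dop_apply_single[of 0 1 P] by (simp add: const_def)
  ultimately show ?case by (simp add: mpoly_eval_alt[of "{0}"])
next
  case (Suc k)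
  have "homogeneous k (dop_apply (linear_dop x) P)"
    using homogeneous_dop_apply[OF Suc.prems homogeneous_linear_dop] by simp
  moreover have "dop_apply (linear_dop x ^ Suc k) P =
      dop_apply (linear_dop x ^ k) (dop_apply (linear_dop x) P)"
    by (simp only: power_Suc2 dop_apply_mult)
  ultimately show ?case
    by (simp add: Suc.IH euler_identity[OF Suc.prems] del: power_Suc)
qed

section \<open>Classes of operators\<close>

abbreviation rcos :: "'m::finite mpolynomial \<Rightarrow> 'm dop \<Rightarrow> 'm dop set" where
  "rcos V D \<equiv> Ann V +>\<^bsub>DOp\<^esub> D"

lemma cring_AV: "cring (AV V)"
  unfolding AV_def by (rule ideal.quotient_is_cring[OF ideal_Ann cring_DOp])

lemma rcos_in_carrier: "rcos V D \<in> carrier (AV V)"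
  by (auto simp: AV_def FactRing_def A_RCOSETS_def')

lemma rcos_hom: "rcos V \<in> ring_hom DOp (AV V)"
  unfolding AV_def by (rule ideal.rcos_ring_hom[OF ideal_Ann])

lemma rcos_mult: "rcos V D \<otimes>\<^bsub>AV V\<^esub> rcos V E = rcos V (D * E)"
  using ring_hom_mult[OF rcos_hom, of D E] by simp

lemma rcos_add: "rcos V D \<oplus>\<^bsub>AV V\<^esub> rcos V E = rcos V (D + E)"
  using ring_hom_add[OF rcos_hom, of D E] by simp

lemma rcos_0: "\<zero>\<^bsub>AV V\<^esub> = rcos V 0"
  using ring_hom_zero[OF rcos_hom[of V] cring.axioms(1)[OF cring_DOp] cring.axioms(1)[OF cring_AV]]
  by simp

lemma rcos_power: "rcos V D [^]\<^bsub>AV V\<^esub> (n::nat) = rcos V (D ^ n)"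
proof (induction n)
  case 0
  then show ?case using ring_hom_one[OF rcos_hom, of V] by simp
next
  case (Suc n)
  then show ?case by (simp add: rcos_mult mult.commute)
qed

text \<open>\<open>Ann V\<close> is the kernel of applying operators to \<open>V\<close>, so its
  cosets are the fibres of that map. Questions about classes become questions about the polynomials
  \<open>D V\<close>.\<close>

lemma mem_rcos_iff: "E \<in> rcos V D \<longleftrightarrow> dop_apply E V = dop_apply D V"
proof
  assume "dop_apply E V = dop_apply D V"
  then have "dop_apply (E - D) V = 0"
    using dop_apply_add[of "E - D" D V] by simp
  then show "E \<in> rcos V D"
    by (auto simp: a_r_coset_def' Ann_def intro: exI[of _ "E - D"])
qed (auto simp: a_r_coset_def' Ann_def dop_apply_add)

lemma rcos_eq_iff: "rcos V D = rcos V E \<longleftrightarrow> dop_apply D V = dop_apply E V"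
  by (auto simp: mem_rcos_iff set_eq_iff)

lemma AV_scale_rcos: "AV_scale V c (rcos V D) = rcos V (const c * D)"
  by (simp add: AV_scale_def rcos_mult)

text \<open>Operators commute, so \<open>D\<close> can act first. The remaining power of a linear
  operator then meets the form \<open>D V\<close> of degree \<open>k\<close>.\<close>

lemma Q_form_rcos:
  assumes "homogeneous d V" "k \<le> d" "homogeneous (d - k) D"
  shows "Q_form V k (rcos V D) (rcos V (linear_dop a)) = fact k * mpoly_eval (dop_apply D V) a"
proof -
  have "homogeneous k (dop_apply D V)"
    using homogeneous_dop_apply[OF assms(1,3)] assms(2) by simp
  then show ?thesis
    by (simp add: Q_form_def rcos_power rcos_mult AV_apply_rcos mult.commute[of D] dop_apply_mult
        lookup_linear_dop_power)
qed

lemma AV_part_1: "AV_part V 1 = range (\<lambda>a. rcos V (linear_dop a))"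
  unfolding AV_part_def homogeneous_1_iff by auto

text \<open>The two forms differ by the positive factor \<open>fact k\<close>, and every element of
  \<open>AV_part V 1\<close> is the class of some \<open>linear_dop a\<close>.\<close>

lemma admissible_Q_form_iff:
  assumes "homogeneous d V" "k \<le> d" "homogeneous (d - k) D"
  shows "admissible_on (AV_part V 1) (Q_form V k (rcos V D)) \<longleftrightarrow>
    admissible_on UNIV (mpoly_eval (dop_apply D V))"
  by (simp add: admissible_on_def AV_part_1 Q_form_rcos[OF assms] zero_less_mult_iff mult_less_0_iff
      del: One_nat_def)

section \<open>The cone of powers\<close>

text \<open>The cone of powers lifted from \<open>AV V\<close> to operators. Adding one generator at
  a time permits repetitions, which sums indexed by a set of classes do not.\<close>

inductive_set power_cone :: "nat \<Rightarrow> 'm::finite dop set" for k where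
  zero: "0 \<in> power_cone k"
| step: "D \<in> power_cone k \<Longrightarrow> 0 \<le> c \<Longrightarrow> const c * linear_dop a ^ k + D \<in> power_cone k"

lemma homogeneous_power_cone: "D \<in> power_cone k \<Longrightarrow> homogeneous k D"
proof (induction rule: power_cone.induct)
  case (step D c a)
  have "homogeneous k (linear_dop a ^ k)"
    using homogeneous_power[OF homogeneous_linear_dop, of k a] by simp
  with step show ?case
    by (intro homogeneous_add homogeneous_const_mult)
qed simp

lemma power_cone_add: "D \<in> power_cone k \<Longrightarrow> E \<in> power_cone k \<Longrightarrow> D + E \<in> power_cone k"
  by (induction rule: power_cone.induct) (auto simp: add.assoc intro: power_cone.intros)

lemma power_cone_scale: "D \<in> power_cone k \<Longrightarrow> 0 \<le> s \<Longrightarrow> const s * D \<in> power_cone k"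
proof (induction rule: power_cone.induct)
  case (step D c a)
  have "const s * (const c * linear_dop a ^ k + D) = const (s * c) * linear_dop a ^ k + const s * D"
    by (simp add: const_def distrib_left mult_single flip: mult.assoc)
  with step show ?case by (auto intro: power_cone.step)
qed (auto intro: power_cone.zero)

text \<open>Induction on the finite set of classes gives one inclusion, induction on the
  construction of \<open>power_cone\<close> the other.\<close>

lemma AV_cone_eq:
  "AV_cone V {x [^]\<^bsub>AV V\<^esub> k | x. x \<in> AV_part V 1} = rcos V ` power_cone k"
proof -
  interpret cring "AV V" by (rule cring_AV)
  define S where "S = {x [^]\<^bsub>AV V\<^esub> k | x. x \<in> AV_part V 1}"
  have S: "S = range (\<lambda>a. rcos V (linear_dop a ^ k))"
    by (auto simp: S_def AV_part_1 image_iff rcos_power[symmetric] simp del: One_nat_def)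
  have in_carrier: "AV_scale V c \<xi> \<in> carrier (AV V)" if "\<xi> \<in> S" for c \<xi>
    using that by (auto simp: S AV_scale_rcos rcos_in_carrier)
  have "(\<Oplus>\<^bsub>AV V\<^esub>\<xi>\<in>Y. AV_scale V (c \<xi>) \<xi>) \<in> rcos V ` power_cone k"
    if "finite Y" "Y \<subseteq> S" "\<forall>\<xi>\<in>Y. 0 \<le> c \<xi>" for Y c
    using that
  proof (induction Y rule: finite_induct)
    case empty
    then show ?case by (auto simp: rcos_0 intro: power_cone.zero)
  next
    case (insert \<xi> Y)
    then obtain D a where D: "D \<in> power_cone k" "(\<Oplus>\<^bsub>AV V\<^esub>\<xi>\<in>Y. AV_scale V (c \<xi>) \<xi>) = rcos V D"
      and a: "\<xi> = rcos V (linear_dop a ^ k)" by (auto simp: S)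
    have "(\<Oplus>\<^bsub>AV V\<^esub>\<xi>\<in>insert \<xi> Y. AV_scale V (c \<xi>) \<xi>) = rcos V (const (c \<xi>) * linear_dop a ^ k + D)"
      using insert in_carrier D by (subst finsum_insert) (auto simp: a AV_scale_rcos rcos_add rcos_in_carrier)
    with insert D show ?case by (auto intro: power_cone.step)
  qed
  moreover have "rcos V D \<in> AV_cone V S" if "D \<in> power_cone k" for D
    using that
  proof (induction rule: power_cone.induct)
    case zero
    show ?case
      unfolding AV_cone_def by (auto simp: rcos_0[symmetric] intro!: exI[of _ "{}"])
  next
    case (step D s a)
    then obtain Y c where Y: "finite Y" "Y \<subseteq> S" "\<forall>\<xi>\<in>Y. 0 \<le> c \<xi>"
      and D: "rcos V D = (\<Oplus>\<^bsub>AV V\<^esub>\<xi>\<in>Y. AV_scale V (c \<xi>) \<xi>)"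
      by (auto simp: AV_cone_def)
    define \<eta> where "\<eta> = rcos V (linear_dop a ^ k)"
    \<comment> \<open>The class of the new power may already be in \<open>Y\<close>. Its coefficient
      then grows by \<open>s\<close>; otherwise it enters with coefficient \<open>s\<close>.
      Splitting off \<open>\<eta>\<close> from the sum serves both cases.\<close>
    define c' where "c' = c(\<eta> := s + (if \<eta> \<in> Y then c \<eta> else 0))"
    have \<eta>: "\<eta> \<in> S" by (auto simp: S \<eta>_def)
    have sub: "AV_scale V (c \<xi>) \<xi> \<in> carrier (AV V)" if "\<xi> \<in> Y" for c \<xi>
      using that Y in_carrier by blast
    have add: "AV_scale V (s + t) \<eta> = AV_scale V s \<eta> \<oplus>\<^bsub>AV V\<^esub> AV_scale V t \<eta>" for t
      by (simp add: \<eta>_def AV_scale_rcos rcos_add const_def single_add distrib_right)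
    have rest: "(\<Oplus>\<^bsub>AV V\<^esub>\<xi>\<in>Y - {\<eta>}. AV_scale V (c' \<xi>) \<xi>) = (\<Oplus>\<^bsub>AV V\<^esub>\<xi>\<in>Y - {\<eta>}. AV_scale V (c \<xi>) \<xi>)"
      using sub by (intro finsum_cong') (auto simp: c'_def)
    have closed: "(\<Oplus>\<^bsub>AV V\<^esub>\<xi>\<in>Y - {\<eta>}. AV_scale V (c \<xi>) \<xi>) \<in> carrier (AV V)"
      using sub by (intro finsum_closed) auto
    have split: "(\<Oplus>\<^bsub>AV V\<^esub>\<xi>\<in>insert \<eta> (Y - {\<eta>}). AV_scale V (e \<xi>) \<xi>) =
        AV_scale V (e \<eta>) \<eta> \<oplus>\<^bsub>AV V\<^esub> (\<Oplus>\<^bsub>AV V\<^esub>\<xi>\<in>Y - {\<eta>}. AV_scale V (e \<xi>) \<xi>)" for e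
      using Y(1) sub in_carrier[OF \<eta>] by (intro finsum_insert) auto
    have "rcos V (const s * linear_dop a ^ k + D) = AV_scale V s \<eta> \<oplus>\<^bsub>AV V\<^esub> rcos V D"
      by (simp add: \<eta>_def AV_scale_rcos rcos_add)
    also have "\<dots> = (\<Oplus>\<^bsub>AV V\<^esub>\<xi>\<in>insert \<eta> (Y - {\<eta>}). AV_scale V (c' \<xi>) \<xi>)"
    proof (cases "\<eta> \<in> Y")
      case True
      then have "rcos V D = AV_scale V (c \<eta>) \<eta> \<oplus>\<^bsub>AV V\<^esub> (\<Oplus>\<^bsub>AV V\<^esub>\<xi>\<in>Y - {\<eta>}. AV_scale V (c \<xi>) \<xi>)"
        unfolding D using split[of c] by (simp add: insert_absorb)
      with True show ?thesis
        unfolding split rest using closed in_carrier[OF \<eta>]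
        by (simp add: c'_def add a_assoc)
    next
      case False
      then show ?thesis
        unfolding split rest by (simp add: D c'_def)
    qed
    finally have "rcos V (const s * linear_dop a ^ k + D) =
      (\<Oplus>\<^bsub>AV V\<^esub>\<xi>\<in>insert \<eta> (Y - {\<eta>}). AV_scale V (c' \<xi>) \<xi>)" .
    moreover have "\<forall>\<xi>\<in>insert \<eta> (Y - {\<eta>}). 0 \<le> c' \<xi>"
      using Y(3) step by (auto simp: c'_def)
    moreover have "finite (insert \<eta> (Y - {\<eta>}))" "insert \<eta> (Y - {\<eta>}) \<subseteq> S"
      using Y \<eta> by auto
    ultimately show ?case
      unfolding AV_cone_def by blast
  qed
  ultimately show ?thesis
    unfolding S_def[symmetric] by (auto simp: AV_cone_def[of V S])
qed

section \<open>Duality between the cone of powers and the signs of forms\<close>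

text \<open>A generator pairs with \<open>P\<close> to a positive multiple of a value of
  \<open>P\<close>, so a semidefinite form has one sign on the whole cone. The factor
  \<open>s\<close> treats both signs at once.\<close>

lemma power_cone_sign:
  assumes "D \<in> power_cone k" "homogeneous k P" "\<And>a. 0 \<le> s * mpoly_eval P a"
  shows "0 \<le> s * Poly_Mapping.lookup (dop_apply D P) 0"
  using assms(1)
proof (induction rule: power_cone.induct)
  case (step D c a)
  have "s * Poly_Mapping.lookup (dop_apply (const c * linear_dop a ^ k + D) P) 0 =
      c * fact k * (s * mpoly_eval P a) + s * Poly_Mapping.lookup (dop_apply D P) 0"
    by (simp add: dop_apply_add dop_apply_const_mult lookup_add lookup_const_mult
        lookup_linear_dop_power[OF assms(2)] algebra_simps)
  with step assms(3) show ?case by simp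
qed simp

text \<open>If \<open>E V\<close> were semidefinite, the whole cone would pair with it in one sign.
  But a full cone contains the classes of a monomial operator and of its negative, and for an
  exponent occurring in \<open>E V\<close> these pair to opposite nonzero values.\<close>

lemma admissible_if_cone_full:
  assumes V: "homogeneous d V" "k \<le> d"
    and cone: "AV_part V k \<subseteq> rcos V ` power_cone k"
    and E: "homogeneous (d - k) E" "dop_apply E V \<noteq> 0"
  shows "admissible_on UNIV (mpoly_eval (dop_apply E V))"
proof -
  let ?P = "dop_apply E V"
  have P: "homogeneous k ?P"
    using homogeneous_dop_apply[OF V(1) E(1)] V(2) by simp
  from E(2) obtain b where b: "Poly_Mapping.lookup ?P b \<noteq> 0"
    by (metis poly_mapping_eqI lookup_zero)
  with P have "(\<Sum>i\<in>UNIV. Poly_Mapping.lookup b i) = k"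
    by (simp add: homogeneous_def in_keys_iff)
  then have hom: "homogeneous k (Poly_Mapping.single b c)" for c
    by (rule homogeneous_single)
  have nonneg: "0 \<le> s * (c * Poly_Mapping.lookup ?P b)" if s: "\<And>a. 0 \<le> s * mpoly_eval ?P a" for s c
  proof -
    have "rcos V (Poly_Mapping.single b c) \<in> AV_part V k"
      using hom by (auto simp: AV_part_def)
    with cone obtain D where D: "D \<in> power_cone k" "rcos V (Poly_Mapping.single b c) = rcos V D"
      by blast
    \<comment> \<open>Equality modulo \<open>Ann V\<close> concerns the action on \<open>V\<close>.
      Applying \<open>E\<close> and commuting carries it over to \<open>E V\<close>.\<close>
    have "dop_apply (Poly_Mapping.single b c) ?P = dop_apply D ?P"
      using D(2) unfolding rcos_eq_iff by (metis dop_apply_mult mult.commute)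
    then have "0 \<le> s * Poly_Mapping.lookup (dop_apply (Poly_Mapping.single b c) ?P) 0"
      using power_cone_sign[OF D(1) P s] by simp
    then have "0 \<le> (\<Prod>i\<in>UNIV. fact (Poly_Mapping.lookup b i)) * (s * (c * Poly_Mapping.lookup ?P b))"
      by (simp add: lookup_dop_apply_single_0 mult_ac)
    moreover have "(0::real) < (\<Prod>i\<in>UNIV. fact (Poly_Mapping.lookup b i))"
      by (intro prod_pos) simp
    ultimately show ?thesis
      by (simp add: zero_le_mult_iff)
  qed
  have sign: "\<exists>a. s * mpoly_eval ?P a < 0" if "s \<noteq> 0" for s
  proof (rule ccontr)
    assume "\<not> ?thesis"
    then have "\<And>a. 0 \<le> s * mpoly_eval ?P a" by (simp add: not_less)
    from nonneg[OF this, of 1] nonneg[OF this, of "- 1"] b that show False by simp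
  qed
  show ?thesis
    using sign[of 1] sign[of "- 1"] by (auto simp: admissible_on_def)
qed

text \<open>Identifying a class with the coefficients of \<open>D V\<close> makes the degree
  \<open>k\<close> part a space of functions on exponents. A functional on it is realised by an
  operator \<open>E\<close>, and a point where \<open>E V\<close> is negative yields a power on
  which the functional is negative.\<close>

lemma cone_full_if_admissible:
  assumes V: "homogeneous d V" "k \<le> d"
    and adm: "\<And>E. homogeneous (d - k) E \<Longrightarrow> dop_apply E V \<noteq> 0 \<Longrightarrow>
      admissible_on UNIV (mpoly_eval (dop_apply E V))"
    and D: "homogeneous k D"
  shows "rcos V D \<in> rcos V ` power_cone k"
proof -
  define I where "I = {b :: 'a \<Rightarrow>\<^sub>0 nat. (\<Sum>i\<in>UNIV. Poly_Mapping.lookup b i) = d - k}"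
  have finI: "finite I" unfolding I_def by (rule finite_exponents)
  let ?co = "\<lambda>D. Poly_Mapping.lookup (dop_apply D V)"
  have co_comb: "(\<lambda>b. s * ?co D b + t * ?co E b) = ?co (const s * D + const t * E)" for s t D E
    by (simp add: fun_eq_iff dop_apply_add dop_apply_const_mult lookup_add lookup_const_mult)
  have "\<exists>c\<in>?co ` power_cone k. \<forall>b\<in>I. c b = ?co D b"
  proof (rule convex_cone_fills_space[OF finI, where W = "?co ` {D. homogeneous k D}"])
    show "?co ` power_cone k \<subseteq> ?co ` {D. homogeneous k D}"
      using homogeneous_power_cone by auto
    show "(\<lambda>_. 0) \<in> ?co ` power_cone k"
      by (rule image_eqI[OF _ power_cone.zero]) (simp add: fun_eq_iff)
    show "(\<lambda>b. s * c b + t * c' b) \<in> ?co ` power_cone k"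
      if "c \<in> ?co ` power_cone k" "c' \<in> ?co ` power_cone k" "0 \<le> s" "0 \<le> t" for c c' s t
      using that by (auto simp: co_comb intro!: imageI power_cone_add power_cone_scale)
    show "(\<lambda>b. s * c b + t * c' b) \<in> ?co ` {D. homogeneous k D}"
      if "c \<in> ?co ` {D. homogeneous k D}" "c' \<in> ?co ` {D. homogeneous k D}" for c c' s t
      using that by (auto simp: co_comb intro!: imageI homogeneous_add homogeneous_const_mult)
    show "?co D \<in> ?co ` {D. homogeneous k D}" using D by blast
    fix f w
    assume w: "w \<in> ?co ` {D. homogeneous k D}" "(\<Sum>b\<in>I. f b * w b) \<noteq> 0"
    \<comment> \<open>The denominators cancel the factorials of
      \<open>lookup_dop_apply_single_0\<close>, so \<open>E\<close> takes \<open>D V\<close> to the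
      value of \<open>f\<close> on its coefficients.\<close>
    define E :: "'a dop" where
      "E = (\<Sum>b\<in>I. Poly_Mapping.single b (f b / (\<Prod>i\<in>UNIV. fact (Poly_Mapping.lookup b i))))"
    have E: "homogeneous (d - k) E"
      unfolding E_def by (intro homogeneous_sum homogeneous_single) (simp add: I_def)
    have pair: "(\<Sum>b\<in>I. f b * ?co D b) = Poly_Mapping.lookup (dop_apply D (dop_apply E V)) 0" for D
    proof -
      have "dop_apply D (dop_apply E V) = dop_apply E (dop_apply D V)"
        by (metis dop_apply_mult mult.commute)
      then show ?thesis
        by (simp add: E_def dop_apply_sum lookup_sum lookup_dop_apply_single_0)
    qed
    have "dop_apply E V \<noteq> 0"
    proof
      assume "dop_apply E V = 0"
      moreover have "dop_apply D 0 = 0" for D :: "'a dop"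
        using dop_apply_right_sum[of D "\<lambda>_. 0" "{}"] by simp
      ultimately show False using w by (auto simp: pair)
    qed
    from adm[OF E this] obtain a where a: "mpoly_eval (dop_apply E V) a < 0"
      by (auto simp: admissible_on_def)
    have "homogeneous k (dop_apply E V)"
      using homogeneous_dop_apply[OF V(1) E] V(2) by simp
    from lookup_linear_dop_power[OF this, of a] a
    have "(\<Sum>b\<in>I. f b * ?co (linear_dop a ^ k) b) < 0"
      unfolding pair by (simp add: mult_less_0_iff)
    moreover have "linear_dop a ^ k \<in> power_cone k"
      using power_cone.step[OF power_cone.zero, of 1 a k] by (simp add: const_def)
    ultimately show "\<exists>c\<in>?co ` power_cone k. (\<Sum>b\<in>I. f b * c b) < 0" by blast
  qed
  then obtain D' where D': "D' \<in> power_cone k" "\<forall>b\<in>I. ?co D' b = ?co D b" by auto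
  have outside: "?co E b = 0" if "homogeneous k E" "b \<notin> I" for E b
  proof (rule ccontr)
    assume "?co E b \<noteq> 0"
    then have "b \<in> Poly_Mapping.keys (dop_apply E V)"
      by (simp add: in_keys_iff)
    with homogeneous_dop_apply[OF V(1) that(1)] that(2) show False
      unfolding I_def homogeneous_def by blast
  qed
  have "?co D' b = ?co D b" for b
    using D'(2) outside[OF D] outside[OF homogeneous_power_cone[OF D'(1)]] by (cases "b \<in> I") auto
  then have "rcos V D = rcos V D'"
    unfolding rcos_eq_iff by (intro poly_mapping_eqI) simp
  then show ?thesis
    using D'(1) by (rule image_eqI)
qed

theorem theorem6p6:
  fixes V :: "'m::finite mpolynomial" and d :: nat
  assumes "homogeneous d V"
  shows
    "((\<forall>k\<in>{1..d}. AV_cone V {x [^]\<^bsub>AV V\<^esub> k | x. x \<in> AV_part V 1} = AV_part V k)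
        \<longleftrightarrow> (\<forall>k\<in>{1..d}. \<forall>\<alpha>\<in>AV_part V (d - k). \<alpha> \<noteq> \<zero>\<^bsub>AV V\<^esub>
              \<longrightarrow> admissible_on (AV_part V 1) (Q_form V k \<alpha>))) \<and>
     ((\<forall>k\<in>{1..d}. \<forall>\<alpha>\<in>AV_part V (d - k). \<alpha> \<noteq> \<zero>\<^bsub>AV V\<^esub>
              \<longrightarrow> admissible_on (AV_part V 1) (Q_form V k \<alpha>))
        \<longleftrightarrow> (\<forall>k<d. \<forall>D :: 'm dop. homogeneous k D \<longrightarrow> dop_apply D V \<noteq> 0
              \<longrightarrow> admissible_on UNIV (mpoly_eval (dop_apply D V))))"
proof -
  \<comment> \<open>Condition (iii) in a single degree. Conditions (i) and (ii) at \<open>k\<close>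
    are each equivalent to \<open>adm (d - k)\<close>, so the equivalences hold degree by
    degree.\<close>
  define adm where "adm j \<longleftrightarrow> (\<forall>D :: 'm dop. homogeneous j D \<longrightarrow> dop_apply D V \<noteq> 0
              \<longrightarrow> admissible_on UNIV (mpoly_eval (dop_apply D V)))" for j
  have ii: "(\<forall>\<alpha>\<in>AV_part V (d - k). \<alpha> \<noteq> \<zero>\<^bsub>AV V\<^esub> \<longrightarrow> admissible_on (AV_part V 1) (Q_form V k \<alpha>))
      \<longleftrightarrow> adm (d - k)" if "k \<in> {1..d}" for k
  proof -
    from that have "k \<le> d" by simp
    note iff = admissible_Q_form_iff[OF assms this]
    have "AV_part V (d - k) = rcos V ` {D. homogeneous (d - k) D}"
      by (auto simp: AV_part_def)
    then show ?thesis
      by (auto simp: adm_def iff rcos_0 rcos_eq_iff simp del: One_nat_def)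
  qed
  have i: "AV_cone V {x [^]\<^bsub>AV V\<^esub> k | x. x \<in> AV_part V 1} = AV_part V k \<longleftrightarrow> adm (d - k)"
    if "k \<in> {1..d}" for k
  proof -
    from that have k: "k \<le> d" by simp
    have sub: "rcos V ` power_cone k \<subseteq> AV_part V k"
      by (auto simp: AV_part_def intro: homogeneous_power_cone)
    show ?thesis
      unfolding AV_cone_eq
    proof
      assume "rcos V ` power_cone k = AV_part V k"
      then show "adm (d - k)"
        unfolding adm_def using admissible_if_cone_full[OF assms k] by blast
    next
      assume "adm (d - k)"
      then have "rcos V D \<in> rcos V ` power_cone k" if "homogeneous k D" for D
        using cone_full_if_admissible[OF assms k _ that] by (auto simp: adm_def)
      with sub show "rcos V ` power_cone k = AV_part V k"
        by (auto simp: AV_part_def)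
    qed
  qed
  \<comment> \<open>The map sending \<open>k\<close> to \<open>d - k\<close> exchanges the range
    from 1 to \<open>d\<close> with the range from 0 to \<open>d - 1\<close>.\<close>
  have "(\<forall>k\<in>{1..d}. adm (d - k)) \<longleftrightarrow> (\<forall>k<d. adm k)"
  proof
    assume *: "\<forall>k\<in>{1..d}. adm (d - k)"
    show "\<forall>k<d. adm k"
    proof (intro allI impI)
      fix k
      assume "k < d"
      with *[THEN bspec, of "d - k"] show "adm k" by simp
    qed
  qed auto
  moreover have "(\<forall>k\<in>{1..d}. AV_cone V {x [^]\<^bsub>AV V\<^esub> k | x. x \<in> AV_part V 1} = AV_part V k)
      \<longleftrightarrow> (\<forall>k\<in>{1..d}. adm (d - k))"
    by (rule ball_cong[OF refl i])
  moreover have "(\<forall>k\<in>{1..d}. \<forall>\<alpha>\<in>AV_part V (d - k). \<alpha> \<noteq> \<zero>\<^bsub>AV V\<^esub>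
              \<longrightarrow> admissible_on (AV_part V 1) (Q_form V k \<alpha>))
      \<longleftrightarrow> (\<forall>k\<in>{1..d}. adm (d - k))"
    by (rule ball_cong[OF refl ii])
  ultimately show ?thesis
    unfolding adm_def by argo
qed

end
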